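(* Let $\theta$ be the map on ballot matrices that performs the move (split or merge) at the least row admitting one, and leaves the matrix unchanged if no row admits a move. For every ballot matrix $A$ on a finite set, $\theta(\theta(A))=A$ and $P(\theta(A))=P(A)$. If $\theta(A)\neq A$, then $A$ and $\theta(A)$ have opposite signs.
   Context: A ballot on a finite set is a (possibly empty) sequence of pairwise disjoint nonempty sets, called blocks, whose union is that set. A ballot matrix of dimension $m\ge 0$ on a finite set $U$ is an upper triangular $m\times m$ array (positions $(i,j)$, $1\le i\le j\le m$) of ballots on pairwise disjoint sets with union $U$ such that every row contains at least one element of $U$. An entry is empty if its ballot has no blocks. If the matrix has dimension $m$ and $k$ blocks in total, its sign is positive if $k+m$ is even and negative if $k+m$ is odd. For a ballot matrix $A$ on $U$ and $x\in U$, let $(\mathrm{row}(x),\mathrm{col}(x))$ be the position of the entry containing $x$. $P(A)$ is the interval order on $U$ given by $x<y\iff \mathrm{col}(x)<\mathrm{row}(y)$. Let $A$ have dimension $m$. For each row $i$, let $f_i$ be the column of its first (leftmost) nonempty entry, and let $S\subseteq[m]$ be the set of empty columns (necessarily $m\notin S$ if $m\ge1$). Row $i$ is splittable if it contains at least two blocks. Row $i$ is mergeable if it contains exactly one block, $i\in S$ and $f_{i+1}\ge f_i$ (so $i<m$). No row is both. A row admits a move if it is splittable or mergeable. Split at a splittable row $i$: let $(i,j)$, $j=f_i$, be the first nonempty entry of row $i$ and $B$ the first block of its ballot. Remove $B$ from it, insert an empty row and an empty column at index $i$ (so old row and column indices $\ge i$ increase by one), and place the one-block ballot $B$ at position $(i,j+1)$;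 the remainder of the ballot from which $B$ was removed is now at $(i+1,j+1)$. The dimension becomes $m+1$. Merge at a mergeable row $i$: let $B$ be its unique block, at $(i,f_i)$; since column $i$ is empty, $f_i>i$. Move $B$ to position $(i+1,f_i)$, placing it as first block ahead of any blocks already there, and then delete row $i$ and column $i$ (indices larger than $i$ decrease by one). The dimension becomes $m-1$. *)

theory Defs
  imports Main
begin

definition ballot :: "'a set \<Rightarrow> 'a set list \<Rightarrow> bool" where
  "ballot X bs \<longleftrightarrow> finite X \<and>
     (\<forall>B \<in> set bs. B \<noteq> {}) \<and>
     (\<forall>p < length bs. \<forall>q < length bs. p \<noteq> q \<longrightarrow> bs ! p \<inter> bs ! q = {}) \<and>
     \<Union> (set bs) = X"

text \<open>An array of ballots with indices starting at 1. For the arrays of interest the entries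
  outside the upper triangle are required to be the empty ballot (see \<open>ballot_matrix\<close>), so that
  HOL equality of two such arrays is equality of dimensions and of all entries.\<close>

datatype 'a barray = BArray (dim: nat) (entry: "nat \<Rightarrow> nat \<Rightarrow> 'a set list")

definition support :: "'a barray \<Rightarrow> nat \<Rightarrow> nat \<Rightarrow> 'a set" where
  "support A i j = \<Union> (set (entry A i j))"

definition ground :: "'a barray \<Rightarrow> 'a set" where
  "ground A = (\<Union>i \<in> {1..dim A}. \<Union>j \<in> {i..dim A}. support A i j)"

definition ballot_matrix :: "'a set \<Rightarrow> 'a barray \<Rightarrow> bool" where
  "ballot_matrix U A \<longleftrightarrow> finite U \<and>
     (\<forall>i j. \<not> (1 \<le> i \<and> i \<le> j \<and> j \<le> dim A) \<longrightarrow> entry A i j = []) \<and>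
     (\<forall>i j. 1 \<le> i \<and> i \<le> j \<and> j \<le> dim A \<longrightarrow> ballot (support A i j) (entry A i j)) \<and>
     (\<forall>i j i' j'. (i, j) \<noteq> (i', j') \<longrightarrow> support A i j \<inter> support A i' j' = {}) \<and>
     ground A = U \<and>
     (\<forall>i \<in> {1..dim A}. \<exists>j \<in> {i..dim A}. \<exists>x \<in> U. x \<in> support A i j)"

definition row_blocks :: "'a barray \<Rightarrow> nat \<Rightarrow> nat" where
  "row_blocks A i = (\<Sum>j = i..dim A. length (entry A i j))"

definition num_blocks :: "'a barray \<Rightarrow> nat" where
  "num_blocks A = (\<Sum>i = 1..dim A. row_blocks A i)"

definition bm_sign :: "'a barray \<Rightarrow> int" where
  "bm_sign A = (if even (num_blocks A + dim A) then 1 else - 1)"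

definition row_of :: "'a barray \<Rightarrow> 'a \<Rightarrow> nat" where
  "row_of A x = (THE i. \<exists>j. x \<in> support A i j)"

definition col_of :: "'a barray \<Rightarrow> 'a \<Rightarrow> nat" where
  "col_of A x = (THE j. \<exists>i. x \<in> support A i j)"

text \<open>The strict order relation, as a set of pairs of elements of the ground set.\<close>

definition interval_order :: "'a barray \<Rightarrow> ('a \<times> 'a) set" where
  "interval_order A = {(x, y). x \<in> ground A \<and> y \<in> ground A \<and> col_of A x < row_of A y}"

definition first_col :: "'a barray \<Rightarrow> nat \<Rightarrow> nat" where
  "first_col A i = (LEAST j. entry A i j \<noteq> [])"

definition empty_cols :: "'a barray \<Rightarrow> nat set" where
  "empty_cols A = {j \<in> {1..dim A}. \<forall>i \<in> {1..j}. entry A i j = []}"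

definition splittable :: "'a barray \<Rightarrow> nat \<Rightarrow> bool" where
  "splittable A i \<longleftrightarrow> i \<in> {1..dim A} \<and> row_blocks A i \<ge> 2"

text \<open>The bound \<open>i < dim A\<close> is automatic for ballot matrices, whose last column is nonempty; it is
  stated so that row \<open>i + 1\<close> visibly exists.\<close>

definition mergeable :: "'a barray \<Rightarrow> nat \<Rightarrow> bool" where
  "mergeable A i \<longleftrightarrow> 1 \<le> i \<and> i < dim A \<and> row_blocks A i = 1 \<and>
     i \<in> empty_cols A \<and> first_col A (i + 1) \<ge> first_col A i"

definition admits_move :: "'a barray \<Rightarrow> nat \<Rightarrow> bool" where
  "admits_move A i \<longleftrightarrow> splittable A i \<or> mergeable A i"

definition set_entry :: "nat \<Rightarrow> nat \<Rightarrow> 'a set list \<Rightarrow> 'a barray \<Rightarrow> 'a barray" where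
  "set_entry i j bs A = BArray (dim A) ((entry A)(i := (entry A i)(j := bs)))"

text \<open>In the next two definitions, indices of the new array are translated back to indices of
  the old one.\<close>

definition insert_row_col :: "nat \<Rightarrow> 'a barray \<Rightarrow> 'a barray" where
  "insert_row_col i A =
     (let old = (\<lambda>p. if p > i then p - 1 else p)
      in BArray (dim A + 1)
           (\<lambda>p q. if p = i \<or> q = i then [] else entry A (old p) (old q)))"

definition delete_row_col :: "nat \<Rightarrow> 'a barray \<Rightarrow> 'a barray" where
  "delete_row_col i A =
     (let old = (\<lambda>p. if p \<ge> i then p + 1 else p)
      in BArray (dim A - 1) (\<lambda>p q. entry A (old p) (old q)))"

definition split_row :: "nat \<Rightarrow> 'a barray \<Rightarrow> 'a barray" where
  "split_row i A =
     (let j = first_col A i; bs = entry A i j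
      in set_entry i (j + 1) [hd bs] (insert_row_col i (set_entry i j (tl bs) A)))"

definition merge_row :: "nat \<Rightarrow> 'a barray \<Rightarrow> 'a barray" where
  "merge_row i A =
     (let j = first_col A i; B = hd (entry A i j)
      in delete_row_col i
           (set_entry (i + 1) j (B # entry A (i + 1) j) (set_entry i j [] A)))"

definition theta :: "'a barray \<Rightarrow> 'a barray" where
  "theta A =
     (if \<exists>i. admits_move A i
      then let i = LEAST i. admits_move A i
           in if splittable A i then split_row i A else merge_row i A
      else A)"

end

theory Submission
  imports Defs
begin

text \<open>
  Splitting and merging at the same row undo each other, and \<open>\<theta>\<close> is an involution because a
  move at row \<open>i\<close> turns that row into one that admits the inverse move, without changing
  whether a row above it admits a move.

  Let \<open>f\<close> denote the first nonempty column of a row. A split at \<open>i\<close> takes the first block \<open>B\<close>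
  of row \<open>i\<close> into a row of its own, above what remains of row \<open>i\<close>, and inserts the
  empty column \<open>i\<close>. As \<open>B\<close> comes from column \<open>f\<^sub>i\<close>, no remaining block lies further left; so
  the new row is mergeable, and merging returns \<open>B\<close> to the front of its old ballot
  (\<open>mergeable_split_row\<close>, \<open>merge_row_split_row\<close>). Conversely, the condition \<open>f\<^sub>i \<le> f\<^sub>i\<^sub>+\<^sub>1\<close> on a
  mergeable row says that after the merge its block comes first in what was row \<open>i + 1\<close>,
  which was itself nonempty; hence a split takes off exactly that block
  (\<open>splittable_merge_row\<close>, \<open>split_row_merge_row\<close>).

  Rows above \<open>i\<close> keep their blocks, and columns left of \<open>i\<close> are untouched. The first nonempty
  columns of the rows \<open>1, \<dots>, i\<close> are only renumbered, by an increasing map, so comparisons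
  between them survive and the least row that admits a move stays \<open>i\<close>
  (\<open>admits_move_split_row\<close>).

  A split keeps the blocks and raises the dimension by one, which reverses the sign. It keeps the
  interval order because the renumbering can only confuse the indices \<open>i\<close> and \<open>i + 1\<close>, and no
  element lies in the inserted column \<open>i\<close> (\<open>interval_order_split_row\<close>). These properties are
  proved for splits only: a merge is the inverse of a split of the merged matrix, and
  each of them is symmetric in the two matrices.
\<close>


section \<open>Ballots and ballot matrices\<close>

lemma ballot_Nil [simp]: "ballot X [] \<longleftrightarrow> X = {}"
  by (auto simp: ballot_def)

text \<open>Both moves add or remove the first block of a ballot, so the condition on pairs of
  positions is replaced by a recursive one.\<close>
lemma ballot_Cons:
  "ballot X (B # bs) \<longleftrightarrow>
     finite B \<and> B \<noteq> {} \<and> B \<inter> \<Union> (set bs) = {} \<and> ballot (\<Union> (set bs)) bs \<and> X = B \<union> \<Union> (set bs)"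
proof -
  have "(\<forall>p < length (B # bs). \<forall>q < length (B # bs). p \<noteq> q \<longrightarrow> (B # bs) ! p \<inter> (B # bs) ! q = {}) \<longleftrightarrow>
        (\<forall>q < length bs. B \<inter> bs ! q = {}) \<and>
        (\<forall>p < length bs. \<forall>q < length bs. p \<noteq> q \<longrightarrow> bs ! p \<inter> bs ! q = {})"
    by (simp add: All_less_Suc2 Int_commute) blast
  moreover have "(\<forall>q < length bs. B \<inter> bs ! q = {}) \<longleftrightarrow> B \<inter> \<Union> (set bs) = {}"
    by (auto simp: set_conv_nth)
  ultimately show ?thesis
    unfolding ballot_def by auto
qed

lemma entry_nonempty_of_support: "x \<in> support A p q \<Longrightarrow> entry A p q \<noteq> []"
  by (auto simp: support_def)

lemma in_ground_iff:
  assumes "\<And>p q. entry A p q \<noteq> [] \<Longrightarrow> 1 \<le> p \<and> p \<le> q \<and> q \<le> dim A"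
  shows "x \<in> ground A \<longleftrightarrow> (\<exists>p q. x \<in> support A p q)"
proof
  assume "\<exists>p q. x \<in> support A p q"
  then obtain p q where x: "x \<in> support A p q" by blast
  then have "1 \<le> p \<and> p \<le> q \<and> q \<le> dim A"
    using assms entry_nonempty_of_support by metis
  then show "x \<in> ground A"
    unfolding ground_def using x by (intro UN_I[of p] UN_I[of q]) auto
qed (auto simp: ground_def)

text \<open>Since blocks are nonempty, an entry is nonempty exactly if its support is. This leaves
  index ranges only in the conditions on triangularity and on nonempty rows; the others can be
  checked after a move without asking whether a renumbered index is still in range.\<close>
lemma ballot_matrix_iff:
  "ballot_matrix U A \<longleftrightarrow> finite U \<and>
     (\<forall>p q. entry A p q \<noteq> [] \<longrightarrow> 1 \<le> p \<and> p \<le> q \<and> q \<le> dim A) \<and>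
     (\<forall>p q. ballot (support A p q) (entry A p q)) \<and>
     (\<forall>p q p' q' x. x \<in> support A p q \<and> x \<in> support A p' q' \<longrightarrow> p = p' \<and> q = q') \<and>
     (\<forall>x. x \<in> U \<longleftrightarrow> (\<exists>p q. x \<in> support A p q)) \<and>
     (\<forall>p. 1 \<le> p \<and> p \<le> dim A \<longrightarrow> (\<exists>q. entry A p q \<noteq> []))"
  (is "?L \<longleftrightarrow> ?R")
proof
  assume L: ?L
  then have out: "entry A p q \<noteq> [] \<Longrightarrow> 1 \<le> p \<and> p \<le> q \<and> q \<le> dim A" for p q
    unfolding ballot_matrix_def by blast
  have bal: "ballot (support A p q) (entry A p q)" for p q
    using L unfolding ballot_matrix_def
    by (cases "1 \<le> p \<and> p \<le> q \<and> q \<le> dim A") (auto simp: support_def)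
  have dis: "p = p' \<and> q = q'" if "x \<in> support A p q" "x \<in> support A p' q'" for p q p' q' x
    using L that unfolding ballot_matrix_def by (metis IntI empty_iff prod.inject)
  have gr: "x \<in> U \<longleftrightarrow> (\<exists>p q. x \<in> support A p q)" for x
    using in_ground_iff[OF out, of x] L unfolding ballot_matrix_def by simp
  have row: "\<exists>q. entry A p q \<noteq> []" if "1 \<le> p" "p \<le> dim A" for p
    using L that entry_nonempty_of_support unfolding ballot_matrix_def by (meson atLeastAtMost_iff)
  have "finite U" using L unfolding ballot_matrix_def by simp
  then show ?R using out bal dis gr row by blast
next
  assume R: ?R
  have ne: "\<exists>x. x \<in> support A p q" if "entry A p q \<noteq> []" for p q
  proof -
    have "ballot (support A p q) (entry A p q)" using R by blast
    then show ?thesis using that by (cases "entry A p q") (auto simp: ballot_Cons)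
  qed
  have out: "entry A p q \<noteq> [] \<Longrightarrow> 1 \<le> p \<and> p \<le> q \<and> q \<le> dim A" for p q
    using R by blast
  have gr: "x \<in> U \<longleftrightarrow> (\<exists>p q. x \<in> support A p q)" for x
    using R by blast
  have "ground A = U"
    using in_ground_iff[OF out] gr by blast
  moreover have "\<exists>j \<in> {i..dim A}. \<exists>x \<in> U. x \<in> support A i j" if i: "i \<in> {1..dim A}" for i
  proof -
    obtain j where "entry A i j \<noteq> []" using R i by auto
    then show ?thesis using out ne gr by (meson atLeastAtMost_iff)
  qed
  moreover have "support A i j \<inter> support A i' j' = {}" if "(i, j) \<noteq> (i', j')" for i j i' j'
    using R that by blast
  moreover have "finite U" "\<And>p q. ballot (support A p q) (entry A p q)"
    using R by blast+
  ultimately show ?L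
    unfolding ballot_matrix_def using out by blast
qed

context
  fixes U :: "'a set" and A :: "'a barray"
  assumes bm: "ballot_matrix U A"
begin

lemma ballot_matrix_triangular:
  "entry A p q \<noteq> [] \<Longrightarrow> 1 \<le> p \<and> p \<le> q \<and> q \<le> dim A"
  using bm unfolding ballot_matrix_iff by blast

lemma ballot_matrix_ballot: "ballot (support A p q) (entry A p q)"
  using bm unfolding ballot_matrix_iff by blast

lemma ballot_matrix_position_unique:
  "x \<in> support A p q \<Longrightarrow> x \<in> support A p' q' \<Longrightarrow> p = p' \<and> q = q'"
  using bm unfolding ballot_matrix_iff by blast

lemma ballot_matrix_carrier: "x \<in> U \<longleftrightarrow> (\<exists>p q. x \<in> support A p q)"
  using bm unfolding ballot_matrix_iff by blast

lemma ballot_matrix_ground: "ground A = U"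
  using bm unfolding ballot_matrix_def by blast

lemma ballot_matrix_row_nonempty: "1 \<le> p \<Longrightarrow> p \<le> dim A \<Longrightarrow> \<exists>q. entry A p q \<noteq> []"
  using bm unfolding ballot_matrix_iff by blast

lemma row_of_eq: "x \<in> support A p q \<Longrightarrow> row_of A x = p"
  unfolding row_of_def using ballot_matrix_position_unique by (intro the_equality) blast+

lemma col_of_eq: "x \<in> support A p q \<Longrightarrow> col_of A x = q"
  unfolding col_of_def using ballot_matrix_position_unique by (intro the_equality) blast+

lemma entry_first_col:
  assumes "1 \<le> p" "p \<le> dim A"
  shows "entry A p (first_col A p) \<noteq> []"
  unfolding first_col_def using ballot_matrix_row_nonempty[OF assms] by (rule LeastI_ex)

lemma first_col_bounds:
  assumes "1 \<le> p" "p \<le> dim A"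
  shows "p \<le> first_col A p" "first_col A p \<le> dim A"
  using ballot_matrix_triangular[OF entry_first_col[OF assms]] by auto

lemma row_blocks_eq_sum_atMost: "row_blocks A p = (\<Sum>q\<le>dim A. length (entry A p q))"
  unfolding row_blocks_def using ballot_matrix_triangular
  by (intro sum.mono_neutral_left) fastforce+

lemma num_blocks_eq_sum_atMost: "num_blocks A = (\<Sum>p\<le>dim A. \<Sum>q\<le>dim A. length (entry A p q))"
  unfolding num_blocks_def row_blocks_eq_sum_atMost using ballot_matrix_triangular
  by (intro sum.mono_neutral_left) fastforce+

lemma single_block_row:
  assumes "1 \<le> p" "p \<le> dim A" "row_blocks A p = 1"
  shows "entry A p q = (if q = first_col A p then [hd (entry A p q)] else [])"
proof -
  let ?f = "\<lambda>q. length (entry A p q)" and ?j = "first_col A p"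
  have "(\<Sum>q\<le>dim A. ?f q) = ?f ?j + (\<Sum>q\<in>{..dim A} - {?j}. ?f q)"
    using first_col_bounds[OF assms(1,2)] by (intro sum.remove) auto
  moreover have "?f ?j \<noteq> 0" using entry_first_col[OF assms(1,2)] by simp
  ultimately have one: "?f ?j = 1" and "(\<Sum>q\<in>{..dim A} - {?j}. ?f q) = 0"
    using assms(3) unfolding row_blocks_eq_sum_atMost by linarith+
  then have "q \<noteq> ?j \<Longrightarrow> entry A p q = []"
    using ballot_matrix_triangular[of p q] by auto
  moreover have "entry A p ?j = [hd (entry A p ?j)]"
    using one by (metis One_nat_def length_0_conv length_Suc_conv list.sel(1))
  ultimately show ?thesis by auto
qed

end

lemma first_col_le: "entry A p q \<noteq> [] \<Longrightarrow> first_col A p \<le> q"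
  unfolding first_col_def by (rule Least_le)

lemma first_colI:
  "entry A p j \<noteq> [] \<Longrightarrow> (\<And>q. entry A p q \<noteq> [] \<Longrightarrow> j \<le> q) \<Longrightarrow> first_col A p = j"
  unfolding first_col_def by (rule Least_equality)


section \<open>Renumbering around an inserted index\<close>

definition skip :: "nat \<Rightarrow> nat \<Rightarrow> nat" where
  "skip i p = (if p < i then p else Suc p)"

text \<open>Both copies \<open>i\<close> and \<open>i + 1\<close> of the index \<open>i\<close> are sent to \<open>i\<close>: a split distributes
  row \<open>i\<close> over these two rows, so this map recovers the old row of every element.\<close>
definition unskip :: "nat \<Rightarrow> nat \<Rightarrow> nat" where
  "unskip i p = (if p > i then p - 1 else p)"

lemma skip_neq [simp]: "skip i p \<noteq> i"
  by (auto simp: skip_def)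

lemma unskip_skip [simp]: "unskip i (skip i p) = p"
  by (auto simp: skip_def unskip_def)

lemma skip_unskip [simp]: "p \<noteq> i \<Longrightarrow> skip i (unskip i p) = p"
  by (auto simp: skip_def unskip_def)

lemma skip_le_iff [simp]: "skip i p \<le> skip i q \<longleftrightarrow> p \<le> q"
  by (auto simp: skip_def)

lemma unskip_less_iff: "q \<noteq> i \<Longrightarrow> unskip i q < unskip i p \<longleftrightarrow> q < p"
  by (auto simp: unskip_def)

lemma sum_skip:
  fixes f :: "nat \<Rightarrow> nat"
  assumes "i \<le> Suc m"
  shows "(\<Sum>q\<le>Suc m. f q) = f i + (\<Sum>q\<le>m. f (skip i q))"
proof -
  have "(\<Sum>q\<le>Suc m. f q) = f i + (\<Sum>q\<in>{..Suc m} - {i}. f q)"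
    using assms by (intro sum.remove) auto
  also have "(\<Sum>q\<in>{..Suc m} - {i}. f q) = (\<Sum>q\<le>m. f (skip i q))"
    by (rule sum.reindex_bij_witness[where i = "skip i" and j = "unskip i"])
      (use assms in \<open>auto simp: skip_def unskip_def\<close>)
  finally show ?thesis .
qed


section \<open>The two moves, entry by entry\<close>

lemma dim_split_row [simp]: "dim (split_row i A) = Suc (dim A)"
  by (simp add: split_row_def set_entry_def insert_row_col_def Let_def)

lemma entry_split_row:
  assumes "i \<le> first_col A i"
  shows "entry (split_row i A) p q =
    (if p = i then if q = Suc (first_col A i) then [hd (entry A i (first_col A i))] else []
     else if q = i then []
     else if p = Suc i \<and> q = Suc (first_col A i) then tl (entry A i (first_col A i))
     else entry A (unskip i p) (unskip i q))"
  using assms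
  by (auto simp: split_row_def set_entry_def insert_row_col_def Let_def unskip_def)

lemma entry_split_row_skip:
  assumes "i \<le> first_col A i"
  shows "entry (split_row i A) (skip i p) (skip i q) =
    (if p = i \<and> q = first_col A i then tl (entry A i (first_col A i)) else entry A p q)"
  unfolding entry_split_row[OF assms] using assms by (auto simp: skip_def unskip_def)

lemma dim_merge_row [simp]: "dim (merge_row i A) = dim A - 1"
  by (simp add: merge_row_def set_entry_def delete_row_col_def Let_def)

lemma entry_merge_row:
  assumes "i < first_col A i"
  shows "entry (merge_row i A) p q =
    (if p = i \<and> skip i q = first_col A i
     then hd (entry A i (first_col A i)) # entry A (Suc i) (first_col A i)
     else entry A (skip i p) (skip i q))"
  using assms
  by (auto simp: merge_row_def set_entry_def delete_row_col_def Let_def skip_def)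


section \<open>Splitting\<close>

locale row_split =
  fixes U :: "'a set" and A :: "'a barray" and i :: nat
  assumes bm: "ballot_matrix U A" and spl: "splittable A i"
begin

abbreviation "j \<equiv> first_col A i"
definition "B = hd (entry A i j)"
definition "C = tl (entry A i j)"
abbreviation "A' \<equiv> split_row i A"

lemma i_bounds: "1 \<le> i" "i \<le> dim A" "i \<le> j" "j \<le> dim A"
  using spl first_col_bounds[OF bm] by (auto simp: splittable_def)

lemma entry_j: "entry A i j = B # C"
  using entry_first_col[OF bm, of i] i_bounds unfolding B_def C_def by simp

lemmas entry_A' = entry_split_row[of i A, OF i_bounds(3), folded B_def C_def]
lemmas entry_A'_skip = entry_split_row_skip[of i A, OF i_bounds(3), folded C_def]

lemma ballot_j: "finite B" "B \<noteq> {}" "B \<inter> \<Union> (set C) = {}" "ballot (\<Union> (set C)) C"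
  using ballot_matrix_ballot[OF bm, of i j] unfolding entry_j ballot_Cons by auto

text \<open>The elements of the old row \<open>i\<close> are shared out between the new rows \<open>i\<close> and \<open>i + 1\<close>, and
  \<open>unskip i\<close> sends both of these to \<open>i\<close>; all other rows and all columns are merely renumbered. So the old
  position of an element can be read off from its new one.\<close>
lemma support_split:
  assumes "x \<in> support A' p q"
  shows "x \<in> support A (unskip i p) (unskip i q)" "q \<noteq> i"
proof -
  have "support A i j = B \<union> \<Union> (set C)"
    unfolding support_def by (subst entry_j) simp
  moreover have "unskip i (Suc i) = i" "unskip i (Suc j) = j" "unskip i i = i"
    using i_bounds by (auto simp: unskip_def)
  ultimately show "x \<in> support A (unskip i p) (unskip i q)" "q \<noteq> i"
    using assms i_bounds unfolding support_def[of A'] entry_A'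
    by (auto simp: support_def split: if_splits)
qed

lemma support_split_surj:
  assumes "x \<in> support A p q"
  shows "\<exists>p' q'. x \<in> support A' p' q'"
proof (cases "x \<in> support A' (skip i p) (skip i q)")
  case False
  then have "p = i" "q = j" "x \<notin> \<Union> (set C)"
    using assms unfolding support_def entry_A'_skip by (auto split: if_splits)
  then have "x \<in> B" using assms by (simp add: support_def entry_j)
  then have "x \<in> support A' i (Suc j)"
    unfolding support_def entry_A' by simp
  then show ?thesis by blast
qed blast

lemma support_split_unique:
  assumes "x \<in> support A' p q" "x \<in> support A' p' q'"
  shows "p = p' \<and> q = q'"
proof -
  have old: "unskip i p = unskip i p'" "unskip i q = unskip i q'"
    using support_split[OF assms(1)] support_split[OF assms(2)] ballot_matrix_position_unique[OF bm]
    by blast+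
  then have q: "q = q'"
    using support_split(2)[OF assms(1)] support_split(2)[OF assms(2)] skip_unskip by metis
  moreover have "p = p'"
  proof (rule ccontr)
    assume "p \<noteq> p'"
    \<comment> \<open>Only the rows \<open>i\<close> and \<open>i + 1\<close> have the same origin; they share the old ballot at
      \<open>(i, j)\<close>, whose first block is disjoint from the others.\<close>
    then have "(p = i \<and> p' = Suc i) \<or> (p = Suc i \<and> p' = i)"
      using old(1) by (auto simp: unskip_def split: if_splits)
    then have "x \<in> support A' i q" "x \<in> support A' (Suc i) q"
      using assms q by auto
    then have "x \<in> B" "x \<in> \<Union> (set C)"
      using i_bounds unfolding support_def entry_A' by (auto split: if_splits)
    then show False using ballot_j(3) by blast
  qed
  ultimately show ?thesis by blast
qed

text \<open>This is where a second block in row \<open>i\<close> is needed: it keeps row \<open>i + 1\<close> of the new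
  matrix from being empty.\<close>
lemma row_rest_nonempty: "\<exists>q. entry A' (Suc i) q \<noteq> []"
proof (rule ccontr)
  assume "\<not> ?thesis"
  then have "entry A' (skip i i) (skip i q) = []" for q
    by (simp add: skip_def)
  then have "(if q = j then C else entry A i q) = []" for q
    unfolding entry_A'_skip by simp
  then have "C = []" "\<And>q. q \<noteq> j \<Longrightarrow> entry A i q = []"
    by (metis (full_types))+
  then have "(\<Sum>q\<le>dim A. length (entry A i q)) = (\<Sum>q\<le>dim A. if q = j then 1 else 0)"
    using entry_j by (intro sum.cong) auto
  then have "row_blocks A i \<le> 1"
    unfolding row_blocks_eq_sum_atMost[OF bm] by simp
  then show False using spl by (simp add: splittable_def)
qed

lemma ballot_matrix_split_row: "ballot_matrix U (split_row i A)"
proof -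
  have "1 \<le> p \<and> p \<le> q \<and> q \<le> Suc (dim A)" if "entry A' p q \<noteq> []" for p q
  proof (cases "p = i \<or> (p = Suc i \<and> q = Suc j)")
    case True
    then show ?thesis using that i_bounds unfolding entry_A' by (auto split: if_splits)
  next
    case False
    then have "entry A (unskip i p) (unskip i q) \<noteq> []" "q \<noteq> i"
      using that unfolding entry_A' by (auto split: if_splits)
    then show ?thesis
      using ballot_matrix_triangular[OF bm] False by (fastforce simp: unskip_def split: if_splits)
  qed
  moreover have "ballot (support A' p q) (entry A' p q)" for p q
    using ballot_j ballot_matrix_ballot[OF bm, of "unskip i p" "unskip i q"]
    unfolding support_def entry_A' by (auto simp: ballot_Cons)
  moreover have "x \<in> U \<longleftrightarrow> (\<exists>p q. x \<in> support A' p q)" for x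
    unfolding ballot_matrix_carrier[OF bm] using support_split(1) support_split_surj by blast
  moreover have "\<exists>q. entry A' p q \<noteq> []" if p: "1 \<le> p" "p \<le> Suc (dim A)" for p
  proof -
    consider "p = i" | "p = Suc i" | "p \<noteq> i" "p \<noteq> Suc i" by blast
    then show ?thesis
    proof cases
      case 1
      then have "entry A' p (Suc j) \<noteq> []" unfolding entry_A' by simp
      then show ?thesis ..
    next
      case 2
      then show ?thesis using row_rest_nonempty by simp
    next
      case 3
      then have "unskip i p \<noteq> i" "1 \<le> unskip i p" "unskip i p \<le> dim A"
        using p i_bounds by (auto simp: unskip_def)
      moreover from this obtain q where "entry A (unskip i p) q \<noteq> []"
        using ballot_matrix_row_nonempty[OF bm] by blast
      ultimately have "entry A' (skip i (unskip i p)) (skip i q) \<noteq> []"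
        unfolding entry_A'_skip by auto
      then show ?thesis using 3 by auto
    qed
  qed
  moreover have "finite U" using bm unfolding ballot_matrix_def by simp
  ultimately show ?thesis
    unfolding ballot_matrix_iff dim_split_row using support_split_unique by blast
qed

text \<open>For an element moved from position \<open>(r, c)\<close> to \<open>(p, q)\<close> we have \<open>r = unskip i p\<close> and
  \<open>c = unskip i q\<close> with \<open>q \<noteq> i\<close>, because the inserted column is empty. The only indices that
  \<open>unskip i\<close> identifies are \<open>i\<close> and \<open>i + 1\<close>, and no element has column \<open>i\<close>, so comparisons between
  a column and a row are unaffected.\<close>
lemma interval_order_split_row: "interval_order (split_row i A) = interval_order A"
proof -
  note bm' = ballot_matrix_split_row
  have "col_of A' x < row_of A' y \<longleftrightarrow> col_of A x < row_of A y" if xy: "x \<in> U" "y \<in> U" for x y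
  proof -
    obtain p q r s where x: "x \<in> support A' p q" and y: "y \<in> support A' r s"
      using xy ballot_matrix_carrier[OF bm'] by blast
    then show ?thesis
      using support_split[OF x] support_split[OF y] unskip_less_iff
        row_of_eq[OF bm' y] col_of_eq[OF bm' x] row_of_eq[OF bm] col_of_eq[OF bm]
      by metis
  qed
  then show ?thesis
    unfolding interval_order_def ballot_matrix_ground[OF bm] ballot_matrix_ground[OF bm'] by auto
qed

lemma row_blocks_split_skip:
  assumes "p \<noteq> i"
  shows "row_blocks A' (skip i p) = row_blocks A p"
proof -
  have "entry A' (skip i p) (skip i q) = entry A p q" for q
    using assms unfolding entry_A'_skip by simp
  moreover have "entry A' (skip i p) i = []"
    unfolding entry_A' by simp
  ultimately show ?thesis
    unfolding row_blocks_eq_sum_atMost[OF bm] row_blocks_eq_sum_atMost[OF ballot_matrix_split_row]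
      dim_split_row
    using i_bounds by (subst sum_skip[of i]) auto
qed

lemma row_blocks_split_new: "row_blocks A' i = 1"
  unfolding row_blocks_eq_sum_atMost[OF ballot_matrix_split_row] entry_A'
  using i_bounds by (simp add: if_distrib[of length] cong: if_cong)

lemma row_blocks_split_rest: "Suc (row_blocks A' (Suc i)) = row_blocks A i"
proof -
  have "row_blocks A' (Suc i) = (\<Sum>q\<le>dim A. length (entry A' (skip i i) (skip i q)))"
    unfolding row_blocks_eq_sum_atMost[OF ballot_matrix_split_row] dim_split_row
    using i_bounds by (subst sum_skip[of i]) (auto simp: entry_A' skip_def)
  moreover have "(\<Sum>q\<le>dim A. length (entry A i q))
      = (\<Sum>q\<le>dim A. length (entry A' (skip i i) (skip i q)) + (if q = j then 1 else 0))"
    unfolding entry_A'_skip using entry_j by (intro sum.cong) (auto simp: Suc_length_conv)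
  ultimately show ?thesis
    unfolding row_blocks_eq_sum_atMost[OF bm] using i_bounds by (simp add: sum.distrib)
qed

text \<open>The blocks of row \<open>i\<close> are divided as one block in the new row \<open>i\<close> and the others in row
  \<open>i + 1\<close>; all other rows keep their blocks.\<close>
lemma num_blocks_split: "num_blocks A' = num_blocks A"
proof -
  note bm' = ballot_matrix_split_row
  have nb: "num_blocks M = (\<Sum>p\<le>dim M. row_blocks M p)" if "ballot_matrix U M" for M :: "'a barray"
    unfolding num_blocks_eq_sum_atMost[OF that] row_blocks_eq_sum_atMost[OF that] ..
  have "num_blocks A' = row_blocks A' i + (\<Sum>p\<le>dim A. row_blocks A' (skip i p))"
    unfolding nb[OF bm'] dim_split_row using i_bounds by (intro sum_skip) simp
  also have "(\<Sum>p\<le>dim A. row_blocks A' (skip i p))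
      = row_blocks A' (Suc i) + (\<Sum>p\<in>{..dim A} - {i}. row_blocks A p)"
    using i_bounds row_blocks_split_skip
    by (subst sum.remove[of _ i]) (auto simp: skip_def[of i i] intro!: sum.cong)
  also have "row_blocks A' i + \<dots> = row_blocks A i + (\<Sum>p\<in>{..dim A} - {i}. row_blocks A p)"
    using row_blocks_split_new row_blocks_split_rest by simp
  also have "\<dots> = num_blocks A"
    unfolding nb[OF bm] using i_bounds by (subst sum.remove[of _ i]) auto
  finally show ?thesis .
qed

lemma bm_sign_split_row: "bm_sign (split_row i A) = - bm_sign A"
  unfolding bm_sign_def num_blocks_split by simp

lemma first_col_split:
  assumes "1 \<le> p" "p \<le> i"
  shows "first_col A' p = skip i (first_col A p)"
proof (rule first_colI)
  have ne: "entry A p (first_col A p) \<noteq> []"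
    using entry_first_col[OF bm] assms i_bounds by simp
  show "entry A' p (skip i (first_col A p)) \<noteq> []"
  proof (cases "p = i")
    case True
    then show ?thesis using i_bounds by (simp add: entry_A' skip_def)
  next
    case False
    then show ?thesis
      using ne assms entry_A'_skip[of p "first_col A p"] by (simp add: skip_def[of i p])
  qed
next
  fix q assume q: "entry A' p q \<noteq> []"
  show "skip i (first_col A p) \<le> q"
  proof (cases "p = i")
    case True
    then show ?thesis using q i_bounds by (auto simp: entry_A' skip_def split: if_splits)
  next
    case False
    then have "entry A p (unskip i q) \<noteq> []" "q \<noteq> i"
      using q assms by (auto simp: entry_A' unskip_def[of i p] split: if_splits)
    then show ?thesis using first_col_le skip_le_iff skip_unskip by metis
  qed
qed

lemma not_splittable_split_row: "\<not> splittable (split_row i A) i"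
  by (simp add: splittable_def row_blocks_split_new)

lemma mergeable_split_row: "mergeable (split_row i A) i"
proof -
  note bm' = ballot_matrix_split_row
  obtain "entry A' (Suc i) (first_col A' (Suc i)) \<noteq> []" "i \<noteq> first_col A' (Suc i)"
    using entry_first_col[OF bm', of "Suc i"] first_col_bounds[OF bm', of "Suc i"] i_bounds by simp
  then have "skip i j \<le> first_col A' (Suc i)"
    using i_bounds
    by (auto simp: entry_A' unskip_def skip_def split: if_splits dest!: first_col_le)
  then show ?thesis
    using i_bounds row_blocks_split_new first_col_split[of i]
    by (auto simp: mergeable_def empty_cols_def entry_A')
qed

lemma merge_row_split_row: "merge_row i (split_row i A) = A"
proof -
  have f: "first_col A' i = Suc j" "i < first_col A' i"
    using first_col_split[of i] i_bounds by (auto simp: skip_def)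
  have "entry (merge_row i A') p q = entry A p q" for p q
  proof (cases "p = i \<and> q = j")
    case True
    then show ?thesis
      using i_bounds f entry_j by (simp add: entry_merge_row[OF f(2)] entry_A' skip_def)
  next
    case False
    then have "\<not> (p = i \<and> skip i q = first_col A' i)"
      using i_bounds f by (auto simp: skip_def split: if_splits)
    then show ?thesis
      unfolding entry_merge_row[OF f(2)] using False entry_A'_skip[of p q] by auto
  qed
  then show ?thesis by (intro barray.expand) auto
qed

text \<open>This makes \<open>\<theta>\<close> choose the same row before and after a move. The delicate row is
  \<open>i - 1\<close>, whose mergeability refers to the first nonempty column of row \<open>i\<close>: since the block
  split off is the first one of its row, that column is only renumbered.\<close>
lemma admits_move_split_row:
  assumes "r < i"
  shows "admits_move (split_row i A) r \<longleftrightarrow> admits_move A r"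
proof -
  have rb: "row_blocks A' r = row_blocks A r"
    using row_blocks_split_skip[of r] assms by (simp add: skip_def)
  have ec: "r \<in> empty_cols A' \<longleftrightarrow> r \<in> empty_cols A"
    unfolding empty_cols_def using assms i_bounds by (auto simp: entry_A' unskip_def)
  have "1 \<le> r \<Longrightarrow> first_col A' r \<le> first_col A' (r + 1) \<longleftrightarrow> first_col A r \<le> first_col A (r + 1)"
    using first_col_split[of r] first_col_split[of "r + 1"] assms by simp
  then show ?thesis
    unfolding admits_move_def splittable_def mergeable_def
    using rb ec assms i_bounds by auto
qed

end


section \<open>Merging\<close>

locale row_merge =
  fixes U :: "'a set" and A :: "'a barray" and i :: nat
  assumes bm: "ballot_matrix U A" and mrg: "mergeable A i"
begin

abbreviation "j \<equiv> first_col A i"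
definition "B = hd (entry A i j)"
abbreviation "A' \<equiv> merge_row i A"

lemma col_i: "entry A p i = []"
  using mrg ballot_matrix_triangular[OF bm, of p i]
  by (fastforce simp: mergeable_def empty_cols_def)

lemma i_bounds: "1 \<le> i" "Suc i \<le> dim A" "i < j" "j \<le> dim A"
proof -
  show i: "1 \<le> i" "Suc i \<le> dim A"
    using mrg by (auto simp: mergeable_def)
  \<comment> \<open>The block of row \<open>i\<close> is not on the diagonal, as column \<open>i\<close> is empty.\<close>
  moreover have "j \<noteq> i"
    using entry_first_col[OF bm, of i] i col_i[of i] by auto
  ultimately show "i < j" "j \<le> dim A"
    using first_col_bounds[OF bm, of i] by auto
qed

lemma row_i: "entry A i q = (if q = j then [B] else [])"
  using single_block_row[OF bm, of i q] mrg i_bounds unfolding B_def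
  by (cases "q = j") (simp_all add: mergeable_def)

lemmas entry_A' = entry_merge_row[of i A, OF i_bounds(3), folded B_def]

lemma ballot_B: "finite B" "B \<noteq> {}"
  using ballot_matrix_ballot[OF bm, of i j] row_i[of j] by (auto simp: ballot_Cons)

text \<open>The merge sends positions back by \<open>unskip i\<close>: the block of row \<open>i\<close> and the blocks of row
  \<open>i + 1\<close> are united in one row. That the elements stay at unique positions is then
  inherited, because their new positions are functions of the old ones.\<close>
lemma support_merge:
  "x \<in> support A' p q \<longleftrightarrow> (\<exists>p' q'. x \<in> support A p' q' \<and> unskip i p' = p \<and> unskip i q' = q)"
proof
  assume x: "x \<in> support A' p q"
  show "\<exists>p' q'. x \<in> support A p' q' \<and> unskip i p' = p \<and> unskip i q' = q"
  proof (cases "p = i \<and> skip i q = j \<and> x \<in> B")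
    case True
    then have "x \<in> support A i (skip i q)"
      unfolding support_def by (simp add: row_i)
    then show ?thesis using True by (metis unskip_def unskip_skip less_irrefl)
  next
    case False
    then have "x \<in> support A (skip i p) (skip i q)"
      using x unfolding support_def entry_A' by (auto simp: skip_def split: if_splits)
    then show ?thesis by (metis unskip_skip)
  qed
next
  assume "\<exists>p' q'. x \<in> support A p' q' \<and> unskip i p' = p \<and> unskip i q' = q"
  then obtain p' q' where x: "x \<in> support A p' q'" "unskip i p' = p" "unskip i q' = q" by blast
  have q': "q' = skip i q" using x col_i by (metis support_def empty_iff empty_set Union_empty skip_unskip)
  show "x \<in> support A' p q"
  proof (cases "p' = i")
    case True
    then show ?thesis
      using x q' unfolding support_def entry_A' by (auto simp: row_i unskip_def split: if_splits)
  next
    case False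
    then have "p' = skip i p" using x by auto
    then show ?thesis
      using x(1) q' unfolding support_def entry_A' by (auto simp: skip_def)
  qed
qed

lemma ballot_matrix_merge_row: "ballot_matrix U (merge_row i A)"
proof -
  have "1 \<le> p \<and> p \<le> q \<and> q \<le> dim A - 1" if "entry A' p q \<noteq> []" for p q
  proof (cases "p = i \<and> skip i q = j")
    case True
    then show ?thesis using i_bounds by (auto simp: skip_def split: if_splits)
  next
    case False
    then have "entry A (skip i p) (skip i q) \<noteq> []"
      using that unfolding entry_A' by (auto split: if_splits)
    then show ?thesis
      using ballot_matrix_triangular[OF bm, of "skip i p" "skip i q"] i_bounds
      by (auto simp: skip_def split: if_splits)
  qed
  moreover have "ballot (support A' p q) (entry A' p q)" for p q
  proof (cases "p = i \<and> skip i q = j")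
    case True
    have "B \<inter> support A (Suc i) j = {}"
      using ballot_matrix_position_unique[OF bm, of _ i j "Suc i" j] row_i[of j]
      by (auto simp: support_def)
    then show ?thesis
      using True ballot_B ballot_matrix_ballot[OF bm, of "Suc i" j]
      unfolding support_def entry_A' by (simp add: ballot_Cons)
  next
    case False
    then show ?thesis
      using ballot_matrix_ballot[OF bm, of "skip i p" "skip i q"]
      unfolding support_def entry_A' by auto
  qed
  moreover have "p = p' \<and> q = q'" if "x \<in> support A' p q" "x \<in> support A' p' q'" for x p q p' q'
    using that ballot_matrix_position_unique[OF bm] unfolding support_merge by blast
  moreover have "x \<in> U \<longleftrightarrow> (\<exists>p q. x \<in> support A' p q)" for x
    unfolding support_merge ballot_matrix_carrier[OF bm] by blast
  moreover have "\<exists>q. entry A' p q \<noteq> []" if "1 \<le> p" "p \<le> dim A - 1" for p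
  proof -
    have "1 \<le> skip i p" "skip i p \<le> dim A"
      using that i_bounds by (auto simp: skip_def)
    then obtain q where q: "entry A (skip i p) q \<noteq> []"
      using ballot_matrix_row_nonempty[OF bm] by blast
    then have "q = skip i (unskip i q)" using col_i by (metis skip_unskip)
    then have "entry A' p (unskip i q) \<noteq> []"
      using q unfolding entry_A' by simp
    then show ?thesis ..
  qed
  moreover have "finite U" using bm unfolding ballot_matrix_def by simp
  ultimately show ?thesis
    unfolding ballot_matrix_iff dim_merge_row by blast
qed

lemma unskip_j: "skip i (unskip i j) = j"
  using i_bounds by simp

lemma splittable_merge_row: "splittable (merge_row i A) i"
proof -
  have "row_blocks A (Suc i) \<noteq> 0"
    using entry_first_col[OF bm, of "Suc i"] first_col_bounds[OF bm, of "Suc i"] i_bounds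
    unfolding row_blocks_eq_sum_atMost[OF bm] by auto
  moreover have "row_blocks A' i = Suc (row_blocks A (Suc i))"
  proof -
    have d: "dim A = Suc (dim A')" using i_bounds by simp
    have "row_blocks A (Suc i) = (\<Sum>q\<le>dim A'. length (entry A (Suc i) (skip i q)))"
      unfolding row_blocks_eq_sum_atMost[OF bm] d
      using i_bounds by (subst sum_skip[of i]) (auto simp: col_i)
    moreover have "row_blocks A' i =
        (\<Sum>q\<le>dim A'. length (entry A (Suc i) (skip i q)) + (if q = unskip i j then 1 else 0))"
      unfolding row_blocks_eq_sum_atMost[OF ballot_matrix_merge_row] entry_A'
      using unskip_j by (intro sum.cong) (auto simp: skip_def[of i i] dest!: arg_cong[of _ j "unskip i"])
    moreover have "unskip i j \<le> dim A'"
      using i_bounds by (simp add: unskip_def)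
    ultimately show ?thesis by (simp add: sum.distrib)
  qed
  ultimately show ?thesis
    using i_bounds by (simp add: splittable_def)
qed

text \<open>By the condition \<open>f\<^sub>i \<le> f\<^sub>i\<^sub>+\<^sub>1\<close> of mergeability, the moved block is the first one of its
  new row, hence the one that a split takes off again.\<close>
lemma first_col_merge: "first_col A' i = unskip i j"
proof (rule first_colI)
  show "entry A' i (unskip i j) \<noteq> []"
    unfolding entry_A' using unskip_j by simp
  fix q assume q: "entry A' i q \<noteq> []"
  have "j \<le> skip i q"
  proof (cases "skip i q = j")
    case False
    then have "entry A (Suc i) (skip i q) \<noteq> []"
      using q unfolding entry_A' by (simp add: skip_def)
    then show ?thesis
      using first_col_le[of A "Suc i" "skip i q"] mrg by (simp add: mergeable_def)
  qed simp
  then show "unskip i j \<le> q" using unskip_j skip_le_iff by metis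
qed

lemma split_row_merge_row: "split_row i (merge_row i A) = A"
proof -
  have le: "i \<le> first_col A' i" and Sf: "Suc (first_col A' i) = j"
    using i_bounds unfolding first_col_merge by (auto simp: unskip_def)
  have ent: "entry A' i (first_col A' i) = B # entry A (Suc i) j"
    unfolding first_col_merge entry_A' using unskip_j by simp
  have "entry (split_row i A') p q = entry A p q" for p q
  proof (cases "p = i \<or> q = i \<or> (p = Suc i \<and> q = j)")
    case True
    then show ?thesis
      unfolding entry_split_row[OF le] Sf ent using i_bounds by (auto simp: row_i col_i)
  next
    case False
    moreover from this have "unskip i p = i \<Longrightarrow> p = Suc i"
      by (auto simp: unskip_def split: if_splits)
    ultimately have "entry A' (unskip i p) (unskip i q) = entry A p q"
      unfolding entry_A' by auto
    then show ?thesis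
      unfolding entry_split_row[OF le] Sf using False by auto
  qed
  moreover have "dim (split_row i A') = dim A" using i_bounds by simp
  ultimately show ?thesis by (intro barray.expand) auto
qed

end


section \<open>The involution\<close>

text \<open>The row \<open>i\<close> is a parameter here because, for \<open>\<theta>\<close> applied twice, the least row of the second
  matrix is known only through the first.\<close>
lemma theta_eq:
  assumes "admits_move A i" "\<And>r. r < i \<Longrightarrow> \<not> admits_move A r"
  shows "theta A = (if splittable A i then split_row i A else merge_row i A)"
proof -
  have "(LEAST i. admits_move A i) = i"
    using assms by (intro Least_equality) (auto simp: not_less[symmetric])
  then show ?thesis
    unfolding theta_def using assms(1) by (auto simp: Let_def)
qed

theorem theorem5p3:
  fixes U :: "'a set" and A :: "'a barray"
  assumes "ballot_matrix U A"
  shows "ballot_matrix U (theta A) \<and>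
         theta (theta A) = A \<and>
         interval_order (theta A) = interval_order A \<and>
         (theta A \<noteq> A \<longrightarrow> bm_sign (theta A) = - bm_sign A)"
proof (cases "\<exists>i. admits_move A i")
  case False
  then have "theta A = A" by (simp add: theta_def)
  then show ?thesis using assms by simp
next
  case True
  define i where "i = (LEAST i. admits_move A i)"
  have i: "admits_move A i" and least: "\<And>r. r < i \<Longrightarrow> \<not> admits_move A r"
    unfolding i_def using True LeastI_ex not_less_Least by metis+
  show ?thesis
  proof (cases "splittable A i")
    case spl: True
    let ?A' = "split_row i A"
    interpret row_split U A i
      using assms spl by unfold_locales
    have "theta A = ?A'"
      using theta_eq[OF i least] spl by simp
    moreover have "theta ?A' = A"
      using theta_eq[of ?A' i] admits_move_split_row least
        not_splittable_split_row mergeable_split_row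
        merge_row_split_row
      by (simp add: admits_move_def[of ?A' i])
    ultimately show ?thesis
      using ballot_matrix_split_row interval_order_split_row
        bm_sign_split_row
      by simp
  next
    case False
    then have mrg: "mergeable A i"
      using i by (simp add: admits_move_def)
    let ?A' = "merge_row i A"
    interpret row_merge U A i
      using assms mrg by unfold_locales
    interpret split: row_split U ?A' i
      using ballot_matrix_merge_row splittable_merge_row by unfold_locales
    have "theta A = ?A'"
      using theta_eq[OF i least] False by simp
    moreover have "theta ?A' = A"
      using theta_eq[of ?A' i] split.admits_move_split_row least splittable_merge_row
        split_row_merge_row
      by (simp add: admits_move_def[of ?A' i])
    ultimately show ?thesis
      using ballot_matrix_merge_row split.interval_order_split_row split.bm_sign_split_row
      unfolding split_row_merge_row by simp
  qed
qed

end
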